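(* In the stochastic optimal control problem under a parameterized policy, let $\pi=(\theta_0^*,\dots,\theta_{n-1}^* )\in\Theta^n$ be a stationary point of DP. Suppose that for all $k\in\{0,\dots,n-1\}$: (1) for every $x\in\mathbb{R}^N$, $\mu_{\theta_k}(x)$ is continuously differentiable with respect to $\theta_k$ in a neighborhood of $\theta_k^*$; and (2) $\mu_{\theta_k^*}(x)$ is continuously differentiable with respect to $x$ everywhere. Then $\pi$ is a stationary point of the one-shot optimization.
   Context: Setting (stochastic, parameterized policy): horizon $n$; on a complete probability space $(\Omega,\mathcal{F},\mathbb{P})$, $x_0$ is an $\mathbb{R}^N$-valued random variable with distribution $\rho$, and $w_0,\dots,w_{n-1}$ are $\mathbb{R}^W$-valued random variables, with $x_0,w_0,\dots,w_{n-1}$ mutually independent. The action space $A\subseteq\mathbb{R}^M$ is compact; dynamics $f_k:\mathbb{R}^N\times A\times\mathbb{R}^W\to\mathbb{R}^N$, stage costs $c_k:\mathbb{R}^N\times\mathbb{R}^M\to\mathbb{R}$ ($k=0,\dots,n-1$) and terminal cost $c_n:\mathbb{R}^N\to\mathbb{R}$ are at least twice continuously differentiable. $\Theta$ is a parameter space (a subset of a Euclidean space), and for each $\theta\in\Theta$, $\mu_\theta:\mathbb{R}^N\to A$ is a bounded function, such that for all $\epsilon>0$ there is $\delta>0$ with: $\|\theta-\theta'\|<\delta\Rightarrow\sup_{x\in\mathbb{R}^N}\|\mu_\theta(x)-\mu_{\theta'}(x)\|<\epsilon$. For $\pi=(\theta_0,\dots,\theta_{n-1})\in\Theta^n$, define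 backward $J_n^\pi(x)=c_n(x)$, $Q_k^\pi(x,u)=\mathbb{E}_{w_k}[c_k(x,u)+J_{k+1}^\pi(f_k(x,u,w_k))]$, $J_k^\pi(x)=Q_k^\pi(x,\mu_{\theta_k}(x))$, $k=n-1,\dots,0$. The one-shot optimization is $\min_{\pi\in\Theta^n}\mathbb{E}_{x_0}[J_0^\pi(x_0)]$. Standing assumption: this is equivalent to minimizing $\mathbb{E}_{x_0,w_0,\dots,w_{n-1}}[\sum_{i=0}^{n-1}c_i(x_i,\mu_{\theta_i}(x_i))+c_n(x_n)]$ with $x_{i+1}=f_i(x_i,\mu_{\theta_i}(x_i),w_i)$, i.e. these expectations are well defined and the two objectives coincide (as holds, e.g., when the costs are uniformly bounded). Normal cone: for a set $S$ and $s^*\in S$, $\mathcal{N}_S(s^* )$ denotes the normal cone of $S$ at $s^*$, i.e. the set of $v$ with $\langle v,s-s^*\rangle\le o(\|s-s^*\|)$ for $s\in S$, $s\to s^*$ (a nonempty closed convex cone). Stationary point of the one-shot optimization: $\pi=(\theta_0^*,\dots,\theta_{n-1}^* )\in\Theta^n$ with $-\nabla_{\theta_k}\mathbb{E}_{x_0}[J_0^\pi(x_0)]\in\mathcal{N}_\Theta(\theta_k^* )$ for all $k\in\{0,\dots,n-1\}$. Stationary point of DP: $\pi=(\theta_0^*,\dots,\theta_{n-1}^* )\in\Theta^n$ such that for all $k\in\{0,\dots,n-1\}$ and all $x\in\mathbb{R}^N$, $-\nabla_{\theta_k}Q_k^\pi(x,\mu_{\theta_k^*}(x))\in\mathcal{N}_\Theta(\theta_k^*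 )$, where $\nabla_{\theta_k}Q_k^\pi(x,\mu_{\theta_k^*}(x))$ is the gradient of $\theta\mapsto Q_k^\pi(x,\mu_\theta(x))$ at $\theta=\theta_k^*$.
   Formalization: Added, as the claim fails without it: for each k, for θ near θ_k*, the difference quotients in θ of Q_k^π(x_k, μ_θ(x_k)) along the state process of π are almost surely bounded by an integrable random variable; also, each μ_θ is taken to be Borel measurable. *)

theory Defs
  imports "HOL-Probability.Probability"
begin

text \<open>Derivatives are taken within the given set, since policies are only defined for parameters in
  the parameter space and the dynamics only for controls in the action space.  For open sets this is
  ordinary (twice) continuous differentiability.\<close>

definition C1_on :: "'a::real_normed_vector set \<Rightarrow> ('a \<Rightarrow> 'b::real_normed_vector) \<Rightarrow> bool" where
  "C1_on S g \<longleftrightarrow> (\<exists>g' :: 'a \<Rightarrow> 'a \<Rightarrow>\<^sub>L 'b.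
     (\<forall>x\<in>S. (g has_derivative blinfun_apply (g' x)) (at x within S)) \<and> continuous_on S g')"

definition C2_on :: "'a::real_normed_vector set \<Rightarrow> ('a \<Rightarrow> 'b::real_normed_vector) \<Rightarrow> bool" where
  "C2_on S g \<longleftrightarrow> (\<exists>g' :: 'a \<Rightarrow> 'a \<Rightarrow>\<^sub>L 'b.
     (\<forall>x\<in>S. (g has_derivative blinfun_apply (g' x)) (at x within S)) \<and> C1_on S g')"

definition normal_cone :: "'a::real_inner set \<Rightarrow> 'a \<Rightarrow> 'a set" where
  "normal_cone S s = {v. \<forall>\<epsilon>>0. \<exists>\<delta>>0. \<forall>y\<in>S. norm (y - s) < \<delta> \<longrightarrow> v \<bullet> (y - s) \<le> \<epsilon> * norm (y - s)}"

text \<open>Negative gradient condition for \<open>g\<close>, defined on \<open>S\<close>, at \<open>s\<close>.  If the gradient within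
  \<open>S\<close> is not unique, two gradients differ by a vector \<open>d\<close> with both \<open>d\<close> and \<open>- d\<close> in the normal
  cone, so that the condition does not depend on the choice.\<close>

definition neg_gradient_in_normal_cone :: "'a::real_inner set \<Rightarrow> ('a \<Rightarrow> real) \<Rightarrow> 'a \<Rightarrow> bool" where
  "neg_gradient_in_normal_cone S g s \<longleftrightarrow>
     (\<exists>D. (g has_derivative (\<lambda>h. D \<bullet> h)) (at s within S) \<and> - D \<in> normal_cone S s)"

text \<open>\<open>indep_vars\<close> needs a common codomain for the whole family, but the initial state and the
  disturbances have different types; this is its definition for the family
  \<open>x0, w 0, \<dots>, w (n - 1)\<close>.\<close>

definition indep_init_noise ::
  "'s measure \<Rightarrow> nat \<Rightarrow> ('s \<Rightarrow> 'x::topological_space) \<Rightarrow> (nat \<Rightarrow> 's \<Rightarrow> 'w::topological_space) \<Rightarrow> bool" where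
  "indep_init_noise M n x0 w \<longleftrightarrow>
     x0 \<in> borel_measurable M \<and> (\<forall>k<n. w k \<in> borel_measurable M) \<and>
     prob_space.indep_sets M
       (\<lambda>i. case i of 0 \<Rightarrow> {x0 -` B \<inter> space M |B. B \<in> sets borel}
                    | Suc k \<Rightarrow> {w k -` B \<inter> space M |B. B \<in> sets borel}) {..n}"

text \<open>A parameterized policy is a sequence \<open>\<theta>\<close> of parameters, of which only
  \<open>\<theta> 0, \<dots>, \<theta> (n - 1)\<close> are used.  \<open>stage_value\<close> is the state-action value for an arbitrary
  continuation value \<open>V\<close>.\<close>

definition stage_value ::
  "'s measure \<Rightarrow> (nat \<Rightarrow> 's \<Rightarrow> 'w) \<Rightarrow> (nat \<Rightarrow> 'x \<Rightarrow> 'u \<Rightarrow> 'w \<Rightarrow> 'x) \<Rightarrow> (nat \<Rightarrow> 'x \<Rightarrow> 'u \<Rightarrow> real) \<Rightarrow>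
   nat \<Rightarrow> ('x \<Rightarrow> real) \<Rightarrow> 'x \<Rightarrow> 'u \<Rightarrow> real" where
  "stage_value M w f c k V x u = (\<integral>\<omega>. c k x u + V (f k x u (w k \<omega>)) \<partial>M)"

function J_value ::
  "'s measure \<Rightarrow> nat \<Rightarrow> (nat \<Rightarrow> 's \<Rightarrow> 'w) \<Rightarrow> (nat \<Rightarrow> 'x \<Rightarrow> 'u \<Rightarrow> 'w \<Rightarrow> 'x) \<Rightarrow>
   (nat \<Rightarrow> 'x \<Rightarrow> 'u \<Rightarrow> real) \<Rightarrow> ('x \<Rightarrow> real) \<Rightarrow> ('p \<Rightarrow> 'x \<Rightarrow> 'u) \<Rightarrow> (nat \<Rightarrow> 'p) \<Rightarrow> nat \<Rightarrow> 'x \<Rightarrow> real" where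
  "J_value M n w f c cT \<mu> \<theta> k =
     (if k < n
      then (\<lambda>x. stage_value M w f c k (J_value M n w f c cT \<mu> \<theta> (Suc k)) x (\<mu> (\<theta> k) x))
      else cT)"
  by pat_completeness auto
termination
  by (relation "Wellfounded.measure (\<lambda>(M, n, w, f, c, cT, \<mu>, \<theta>, k). n - k)") auto

declare J_value.simps [simp del]

definition Q_value ::
  "'s measure \<Rightarrow> nat \<Rightarrow> (nat \<Rightarrow> 's \<Rightarrow> 'w) \<Rightarrow> (nat \<Rightarrow> 'x \<Rightarrow> 'u \<Rightarrow> 'w \<Rightarrow> 'x) \<Rightarrow>
   (nat \<Rightarrow> 'x \<Rightarrow> 'u \<Rightarrow> real) \<Rightarrow> ('x \<Rightarrow> real) \<Rightarrow> ('p \<Rightarrow> 'x \<Rightarrow> 'u) \<Rightarrow> (nat \<Rightarrow> 'p) \<Rightarrow>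
   nat \<Rightarrow> 'x \<Rightarrow> 'u \<Rightarrow> real" where
  "Q_value M n w f c cT \<mu> \<theta> k = stage_value M w f c k (J_value M n w f c cT \<mu> \<theta> (Suc k))"

lemma J_value_terminal: "J_value M n w f c cT \<mu> \<theta> n = cT"
  by (simp add: J_value.simps)

lemma J_value_step:
  "k < n \<Longrightarrow> J_value M n w f c cT \<mu> \<theta> k x = Q_value M n w f c cT \<mu> \<theta> k x (\<mu> (\<theta> k) x)"
  by (simp add: J_value.simps [of M n w f c cT \<mu> \<theta> k] Q_value_def)

primrec trajectory ::
  "('s \<Rightarrow> 'x) \<Rightarrow> (nat \<Rightarrow> 's \<Rightarrow> 'w) \<Rightarrow> (nat \<Rightarrow> 'x \<Rightarrow> 'u \<Rightarrow> 'w \<Rightarrow> 'x) \<Rightarrow> ('p \<Rightarrow> 'x \<Rightarrow> 'u) \<Rightarrow> (nat \<Rightarrow> 'p) \<Rightarrow>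
   nat \<Rightarrow> 's \<Rightarrow> 'x" where
  "trajectory x0 w f \<mu> \<theta> 0 \<omega> = x0 \<omega>"
| "trajectory x0 w f \<mu> \<theta> (Suc i) \<omega> =
     f i (trajectory x0 w f \<mu> \<theta> i \<omega>) (\<mu> (\<theta> i) (trajectory x0 w f \<mu> \<theta> i \<omega>)) (w i \<omega>)"

definition total_cost ::
  "nat \<Rightarrow> ('s \<Rightarrow> 'x) \<Rightarrow> (nat \<Rightarrow> 's \<Rightarrow> 'w) \<Rightarrow> (nat \<Rightarrow> 'x \<Rightarrow> 'u \<Rightarrow> 'w \<Rightarrow> 'x) \<Rightarrow>
   (nat \<Rightarrow> 'x \<Rightarrow> 'u \<Rightarrow> real) \<Rightarrow> ('x \<Rightarrow> real) \<Rightarrow> ('p \<Rightarrow> 'x \<Rightarrow> 'u) \<Rightarrow> (nat \<Rightarrow> 'p) \<Rightarrow> 's \<Rightarrow> real" where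
  "total_cost n x0 w f c cT \<mu> \<theta> \<omega> =
     (\<Sum>i<n. c i (trajectory x0 w f \<mu> \<theta> i \<omega>) (\<mu> (\<theta> i) (trajectory x0 w f \<mu> \<theta> i \<omega>)))
     + cT (trajectory x0 w f \<mu> \<theta> n \<omega>)"

definition one_shot_objective ::
  "'s measure \<Rightarrow> nat \<Rightarrow> ('s \<Rightarrow> 'x) \<Rightarrow> (nat \<Rightarrow> 's \<Rightarrow> 'w) \<Rightarrow> (nat \<Rightarrow> 'x \<Rightarrow> 'u \<Rightarrow> 'w \<Rightarrow> 'x) \<Rightarrow>
   (nat \<Rightarrow> 'x \<Rightarrow> 'u \<Rightarrow> real) \<Rightarrow> ('x \<Rightarrow> real) \<Rightarrow> ('p \<Rightarrow> 'x \<Rightarrow> 'u) \<Rightarrow> (nat \<Rightarrow> 'p) \<Rightarrow> real" where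
  "one_shot_objective M n x0 w f c cT \<mu> \<theta> = (\<integral>\<omega>. J_value M n w f c cT \<mu> \<theta> 0 (x0 \<omega>) \<partial>M)"

text \<open>The standing assumption that, for every parameter sequence, all expectations are well defined
  and the two forms of the objective coincide.\<close>

definition expectations_well_defined ::
  "'s measure \<Rightarrow> nat \<Rightarrow> ('s \<Rightarrow> 'x) \<Rightarrow> (nat \<Rightarrow> 's \<Rightarrow> 'w) \<Rightarrow> 'u set \<Rightarrow>
   (nat \<Rightarrow> 'x \<Rightarrow> 'u \<Rightarrow> 'w \<Rightarrow> 'x) \<Rightarrow> (nat \<Rightarrow> 'x \<Rightarrow> 'u \<Rightarrow> real) \<Rightarrow> ('x \<Rightarrow> real) \<Rightarrow>
   'p set \<Rightarrow> ('p \<Rightarrow> 'x \<Rightarrow> 'u) \<Rightarrow> bool" where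
  "expectations_well_defined M n x0 w A f c cT \<Theta> \<mu> \<longleftrightarrow>
     (\<forall>\<theta> \<in> {..<n} \<rightarrow> \<Theta>.
        (\<forall>k<n. \<forall>x. \<forall>u\<in>A.
           integrable M (\<lambda>\<omega>. c k x u + J_value M n w f c cT \<mu> \<theta> (Suc k) (f k x u (w k \<omega>)))) \<and>
        integrable M (\<lambda>\<omega>. J_value M n w f c cT \<mu> \<theta> 0 (x0 \<omega>)) \<and>
        integrable M (total_cost n x0 w f c cT \<mu> \<theta>) \<and>
        one_shot_objective M n x0 w f c cT \<mu> \<theta> = (\<integral>\<omega>. total_cost n x0 w f c cT \<mu> \<theta> \<omega> \<partial>M))"

definition one_shot_stationary ::
  "'s measure \<Rightarrow> nat \<Rightarrow> ('s \<Rightarrow> 'x) \<Rightarrow> (nat \<Rightarrow> 's \<Rightarrow> 'w) \<Rightarrow> (nat \<Rightarrow> 'x \<Rightarrow> 'u \<Rightarrow> 'w \<Rightarrow> 'x) \<Rightarrow>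
   (nat \<Rightarrow> 'x \<Rightarrow> 'u \<Rightarrow> real) \<Rightarrow> ('x \<Rightarrow> real) \<Rightarrow> 'p::real_inner set \<Rightarrow> ('p \<Rightarrow> 'x \<Rightarrow> 'u) \<Rightarrow>
   (nat \<Rightarrow> 'p) \<Rightarrow> bool" where
  "one_shot_stationary M n x0 w f c cT \<Theta> \<mu> \<theta> \<longleftrightarrow>
     \<theta> \<in> {..<n} \<rightarrow> \<Theta> \<and>
     (\<forall>k<n. neg_gradient_in_normal_cone \<Theta>
        (\<lambda>\<eta>. one_shot_objective M n x0 w f c cT \<mu> (\<theta>(k := \<eta>))) (\<theta> k))"

definition DP_stationary ::
  "'s measure \<Rightarrow> nat \<Rightarrow> (nat \<Rightarrow> 's \<Rightarrow> 'w) \<Rightarrow> (nat \<Rightarrow> 'x \<Rightarrow> 'u \<Rightarrow> 'w \<Rightarrow> 'x) \<Rightarrow>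
   (nat \<Rightarrow> 'x \<Rightarrow> 'u \<Rightarrow> real) \<Rightarrow> ('x \<Rightarrow> real) \<Rightarrow> 'p::real_inner set \<Rightarrow> ('p \<Rightarrow> 'x \<Rightarrow> 'u) \<Rightarrow>
   (nat \<Rightarrow> 'p) \<Rightarrow> bool" where
  "DP_stationary M n w f c cT \<Theta> \<mu> \<theta> \<longleftrightarrow>
     \<theta> \<in> {..<n} \<rightarrow> \<Theta> \<and>
     (\<forall>k<n. \<forall>x. neg_gradient_in_normal_cone \<Theta>
        (\<lambda>\<eta>. Q_value M n w f c cT \<mu> \<theta> k x (\<mu> \<eta> x)) (\<theta> k))"

text \<open>Regularity that permits differentiating under the expectation: along the state process of
  \<open>\<theta>\<close>, the difference quotients of \<open>\<eta> \<mapsto> Q_k(x_k, \<mu>_\<eta>(x_k))\<close> at \<open>\<theta> k\<close> have an integrable bound.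
  It does not follow from pointwise differentiability, not even for bounded costs.\<close>

definition dominated_difference_quotients ::
  "'s measure \<Rightarrow> nat \<Rightarrow> ('s \<Rightarrow> 'x) \<Rightarrow> (nat \<Rightarrow> 's \<Rightarrow> 'w) \<Rightarrow> (nat \<Rightarrow> 'x \<Rightarrow> 'u \<Rightarrow> 'w \<Rightarrow> 'x) \<Rightarrow>
   (nat \<Rightarrow> 'x \<Rightarrow> 'u \<Rightarrow> real) \<Rightarrow> ('x \<Rightarrow> real) \<Rightarrow> 'p::real_normed_vector set \<Rightarrow> ('p \<Rightarrow> 'x \<Rightarrow> 'u) \<Rightarrow>
   (nat \<Rightarrow> 'p) \<Rightarrow> nat \<Rightarrow> bool" where
  "dominated_difference_quotients M n x0 w f c cT \<Theta> \<mu> \<theta> k \<longleftrightarrow>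
     (\<exists>\<delta>>0. \<exists>L. integrable M L \<and>
        (\<forall>\<eta>\<in>\<Theta>. norm (\<eta> - \<theta> k) < \<delta> \<longrightarrow>
           (AE \<omega> in M.
              let x = trajectory x0 w f \<mu> \<theta> k \<omega>; q = Q_value M n w f c cT \<mu> \<theta> k x
              in \<bar>q (\<mu> \<eta> x) - q (\<mu> (\<theta> k) x)\<bar> \<le> L \<omega> * norm (\<eta> - \<theta> k))))"

end

theory Submission
  imports Defs
begin

text \<open>Let \<open>x\<^sub>k\<close> be the state process of \<open>\<theta>\<close> and \<open>C\<^sub>k\<close> the cost incurred before stage \<open>k\<close>.  Since
  \<open>w\<^sub>k\<close> is independent of \<open>(C\<^sub>k, x\<^sub>k)\<close>, Fubini's theorem gives
  \<open>E[C\<^sub>k\<^sub>+\<^sub>1 + J\<^sub>k\<^sub>+\<^sub>1(x\<^sub>k\<^sub>+\<^sub>1)] = E[C\<^sub>k + J\<^sub>k(x\<^sub>k)]\<close>, so the objective equals \<open>E[C\<^sub>k + J\<^sub>k(x\<^sub>k)]\<close> for every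
  \<open>k\<close>.  Replacing \<open>\<theta> k\<close> by \<open>\<eta>\<close> changes neither \<open>C\<^sub>k\<close> nor \<open>x\<^sub>k\<close>, hence changes the objective by
  \<open>E[Q\<^sub>k(x\<^sub>k, \<mu>\<^sub>\<eta>(x\<^sub>k)) - Q\<^sub>k(x\<^sub>k, \<mu>\<^bsub>\<theta> k\<^esub>(x\<^sub>k))]\<close>.  Dominated convergence then moves the gradient
  condition inside the expectation.\<close>

subsection \<open>Gradients in normal cones under the expectation\<close>

text \<open>If \<open>P\<close> fails arbitrarily close to \<open>s\<close>, the counterexamples
  form a sequence tending to \<open>s\<close>, and compactness of the unit sphere yields a
  subsequence whose directions converge. A single index satisfying \<open>P\<close> on every such
  sequence is already a contradiction.\<close>

lemma eventually_at_within_by_directions: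
  fixes s :: "'p::euclidean_space"
  assumes "\<And>y t. \<lbrakk>\<And>m. y m \<in> S - {s}; y \<longlonglongrightarrow> s; (\<lambda>m. sgn (y m - s)) \<longlonglongrightarrow> t\<rbrakk> \<Longrightarrow> \<exists>m::nat. P (y m)"
  shows "eventually P (at s within S)"
proof (rule ccontr)
  assume "\<not> eventually P (at s within S)"
  then have "\<exists>y\<in>S. y \<noteq> s \<and> dist y s < inverse (real (Suc m)) \<and> \<not> P y" for m
    unfolding eventually_at by force
  then obtain y where y: "\<And>m. y m \<in> S" "\<And>m. y m \<noteq> s" "\<And>m. \<not> P (y m)"
    and close: "\<And>m. dist (y m) s < inverse (real (Suc m))"
    by metis
  have "(\<lambda>m. dist (y m) s) \<longlonglongrightarrow> 0"
    by (rule real_tendsto_sandwich[OF _ _ tendsto_const LIMSEQ_inverse_real_of_nat])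
      (use close in \<open>auto intro!: always_eventually less_imp_le\<close>)
  then have lim: "y \<longlonglongrightarrow> s"
    by (simp flip: tendsto_dist_iff)
  have "sgn (y m - s) \<in> sphere 0 1" for m
    using y(2)[of m] by (simp add: norm_sgn)
  then obtain t r where r: "strict_mono r" and "((\<lambda>m. sgn (y m - s)) \<circ> r) \<longlonglongrightarrow> t"
    using compact_sphere[of "0::'p" 1] unfolding compact_def by metis
  moreover have "(y \<circ> r) \<longlonglongrightarrow> s"
    using LIMSEQ_subseq_LIMSEQ[OF lim r] .
  ultimately have "\<exists>m. P (y (r m))"
    using assms[of "y \<circ> r" t] y by (simp add: o_def)
  then show False
    using y(3) by blast
qed

lemma inner_sgn: "v \<bullet> sgn x = (v \<bullet> x) / norm x"
  by (simp add: sgn_div_norm divide_inverse mult.commute)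

text \<open>Splits the quotient into the remainder from \<open>has_derivative_within\<close> and a
  directional term. The case \<open>y = s\<close> is covered, since both sides are then 0.\<close>

lemma difference_quotient_eq:
  fixes g :: "'p::real_inner \<Rightarrow> real"
  shows "(g y - g s) / norm (y - s) =
    (1 / norm (y - s)) *\<^sub>R (g y - (g s + D \<bullet> (y - s))) + D \<bullet> sgn (y - s)"
  by (simp add: inner_sgn flip: add_divide_distrib)

text \<open>The filter leaves out \<open>s\<close> itself, where the inequality reads 0 <=
  0.\<close>

lemma normal_cone_iff_eventually:
  "v \<in> normal_cone S s \<longleftrightarrow> (\<forall>\<epsilon>>0. \<forall>\<^sub>F y in at s within S. v \<bullet> (y - s) \<le> \<epsilon> * norm (y - s))"
  unfolding normal_cone_def eventually_at
  by (simp add: dist_norm) (metis diff_self inner_zero_right mult_zero_right norm_zero order_refl)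

lemma has_derivative_within_LIMSEQ_direction:
  fixes g :: "'p::real_inner \<Rightarrow> real"
  assumes "(g has_derivative (\<lambda>h. D \<bullet> h)) (at s within S)"
    and y: "\<And>m. y m \<in> S - {s}" "y \<longlonglongrightarrow> s" and t: "(\<lambda>m. sgn (y m - s)) \<longlonglongrightarrow> t"
  shows "(\<lambda>m. (g (y m) - g s) / norm (y m - s)) \<longlonglongrightarrow> D \<bullet> t"
proof -
  have "filterlim y (at s within S) sequentially"
    using y by (auto simp: filterlim_at intro: always_eventually)
  then have "(\<lambda>m. (1 / norm (y m - s)) *\<^sub>R (g (y m) - (g s + D \<bullet> (y m - s)))) \<longlonglongrightarrow> 0"
    by (rule filterlim_compose[OF conjunct2[OF assms(1)[unfolded has_derivative_within]]])
  moreover have "(\<lambda>m. D \<bullet> sgn (y m - s)) \<longlonglongrightarrow> D \<bullet> t"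
    by (intro tendsto_intros t)
  ultimately have "(\<lambda>m. (1 / norm (y m - s)) *\<^sub>R (g (y m) - (g s + D \<bullet> (y m - s))) + D \<bullet> sgn (y m - s))
      \<longlonglongrightarrow> 0 + D \<bullet> t"
    by (rule tendsto_add)
  then show ?thesis
    by (subst difference_quotient_eq[where D = D]) simp
qed

text \<open>Dividing the defining inequality by \<open>norm (y m - s)\<close> bounds
  \<open>v \<bullet> sgn (y m - s)\<close> by any positive \<open>e\<close> eventually, and the
  bound passes to the limit direction.\<close>

lemma normal_cone_inner_direction_le:
  assumes v: "v \<in> normal_cone S s"
    and y: "\<And>m. y m \<in> S - {s}" "y \<longlonglongrightarrow> s" and t: "(\<lambda>m. sgn (y m - s)) \<longlonglongrightarrow> t"
  shows "v \<bullet> t \<le> 0"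
proof (rule field_le_epsilon)
  fix e :: real
  assume "e > 0"
  have "filterlim y (at s within S) sequentially"
    using y by (auto simp: filterlim_at intro: always_eventually)
  with v \<open>e > 0\<close> have "\<forall>\<^sub>F m in sequentially. v \<bullet> (y m - s) \<le> e * norm (y m - s)"
    unfolding normal_cone_iff_eventually filterlim_iff by blast
  then have "\<forall>\<^sub>F m in sequentially. v \<bullet> sgn (y m - s) \<le> e"
    by eventually_elim (use y(1) in \<open>simp add: inner_sgn divide_le_eq\<close>)
  with tendsto_inner[OF tendsto_const t, of v] show "v \<bullet> t \<le> 0 + e"
    by (simp add: tendsto_upperbound)
qed

text \<open>Converse of the two preceding lemmas: differentiability and the cone condition can both
  be tested on sequences with convergent directions. This reduces the claim to limits of sequences,
  the form in which dominated convergence applies.\<close>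

lemma neg_gradient_in_normal_coneI:
  fixes s :: "'p::euclidean_space"
  assumes "\<And>y t. \<lbrakk>\<And>m. y m \<in> S - {s}; y \<longlonglongrightarrow> s; (\<lambda>m. sgn (y m - s)) \<longlonglongrightarrow> t\<rbrakk> \<Longrightarrow>
      (\<lambda>m. (g (y m) - g s) / norm (y m - s)) \<longlonglongrightarrow> D \<bullet> t \<and> 0 \<le> D \<bullet> t"
  shows "neg_gradient_in_normal_cone S g s"
  unfolding neg_gradient_in_normal_cone_def
proof (intro exI conjI)
  show "(g has_derivative (\<lambda>h. D \<bullet> h)) (at s within S)"
    unfolding has_derivative_within
  proof (intro conjI tendstoI)
    show "bounded_linear (\<lambda>h. D \<bullet> h)"
      by (rule bounded_linear_inner_right)
    fix e :: real
    assume "e > 0"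
    show "\<forall>\<^sub>F y in at s within S. dist ((1 / norm (y - s)) *\<^sub>R (g y - (g s + D \<bullet> (y - s)))) 0 < e"
    proof (rule eventually_at_within_by_directions)
      fix y t
      assume y: "\<And>m. y m \<in> S - {s}" "y \<longlonglongrightarrow> s" "(\<lambda>m. sgn (y m - s)) \<longlonglongrightarrow> t"
      have "(\<lambda>m. (g (y m) - g s) / norm (y m - s) - D \<bullet> sgn (y m - s)) \<longlonglongrightarrow> D \<bullet> t - D \<bullet> t"
        using assms[OF y] by (intro tendsto_intros y(3)) auto
      also have "(\<lambda>m. (g (y m) - g s) / norm (y m - s) - D \<bullet> sgn (y m - s)) =
          (\<lambda>m. (1 / norm (y m - s)) *\<^sub>R (g (y m) - (g s + D \<bullet> (y m - s))))"
        by (simp add: difference_quotient_eq[where D = D])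
      finally have "\<forall>\<^sub>F m in sequentially. dist ((1 / norm (y m - s)) *\<^sub>R (g (y m) - (g s + D \<bullet> (y m - s)))) 0 < e"
        using \<open>e > 0\<close> by (simp add: tendsto_iff del: dist_0_norm)
      then show "\<exists>m. dist ((1 / norm (y m - s)) *\<^sub>R (g (y m) - (g s + D \<bullet> (y m - s)))) 0 < e"
        using eventually_happens trivial_limit_sequentially by blast
    qed
  qed
  show "- D \<in> normal_cone S s"
    unfolding normal_cone_iff_eventually
  proof (intro allI impI eventually_at_within_by_directions)
    fix e :: real and y t
    assume "e > 0" and y: "\<And>m. y m \<in> S - {s}" "y \<longlonglongrightarrow> s" "(\<lambda>m. sgn (y m - s)) \<longlonglongrightarrow> t"
    have "(\<lambda>m. - D \<bullet> sgn (y m - s)) \<longlonglongrightarrow> - D \<bullet> t"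
      by (intro tendsto_intros y(3))
    moreover have "- D \<bullet> t < e"
      using assms[OF y] \<open>e > 0\<close> by simp
    ultimately have "\<forall>\<^sub>F m in sequentially. - D \<bullet> sgn (y m - s) < e"
      by (rule order_tendstoD)
    then obtain m where "- D \<bullet> sgn (y m - s) < e"
      using eventually_happens trivial_limit_sequentially by blast
    then have "- D \<bullet> (y m - s) \<le> e * norm (y m - s)"
      using y(1)[of m] by (simp add: inner_sgn field_simps)
    then show "\<exists>m. - D \<bullet> (y m - s) \<le> e * norm (y m - s)" ..
  qed
qed

text \<open>The gradients within \<open>S\<close> are only determined on the span of the tangent directions, so an
  arbitrary choice \<open>d\<close> of them need not be measurable.  Its components along tangent directions are,
  and these suffice to define an expected gradient.\<close>

lemma exists_weak_integral:
  fixes d :: "'s \<Rightarrow> 'p::euclidean_space"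
  obtains D where "\<And>t. integrable M (\<lambda>\<omega>. d \<omega> \<bullet> t) \<Longrightarrow> D \<bullet> t = (\<integral>\<omega>. d \<omega> \<bullet> t \<partial>M)"
proof -
  have "subspace {t. integrable M (\<lambda>\<omega>. d \<omega> \<bullet> t)}"
    by (auto simp: subspace_def inner_add_right)
  then obtain B where B: "B \<subseteq> {t. integrable M (\<lambda>\<omega>. d \<omega> \<bullet> t)}" "pairwise orthogonal B"
    "\<And>b. b \<in> B \<Longrightarrow> norm b = 1" "independent B" "span B = {t. integrable M (\<lambda>\<omega>. d \<omega> \<bullet> t)}"
    by (rule orthonormal_basis_subspace) blast
  have fin: "finite B"
    using B(4) by (rule independent_imp_finite)
  \<comment> \<open>The witness is the sum of \<open>(\<integral>\<omega>. d \<omega> \<bullet> b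
    \<partial>M) *\<^sub>R b\<close> over an orthonormal basis \<open>B\<close> of the subspace of
    those \<open>t\<close> for which \<open>d \<omega> \<bullet> t\<close> is integrable.\<close>
  show ?thesis
  proof (rule that)
    fix t
    assume "integrable M (\<lambda>\<omega>. d \<omega> \<bullet> t)"
    with B(5) have t: "(\<Sum>b\<in>B. (t \<bullet> b) *\<^sub>R b) = t"
      by (intro orthonormal_basis_expand[OF B(2,3) _ fin]) auto
    have "d \<omega> \<bullet> t = (\<Sum>b\<in>B. (t \<bullet> b) * (d \<omega> \<bullet> b))" for \<omega>
      by (subst t[symmetric]) (simp add: inner_sum_right)
    then have "(\<integral>\<omega>. d \<omega> \<bullet> t \<partial>M) = (\<Sum>b\<in>B. (t \<bullet> b) * (\<integral>\<omega>. d \<omega> \<bullet> b \<partial>M))"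
      using B(1) by (simp add: subset_iff)
    then show "(\<Sum>b\<in>B. (\<integral>\<omega>. d \<omega> \<bullet> b \<partial>M) *\<^sub>R b) \<bullet> t = (\<integral>\<omega>. d \<omega> \<bullet> t \<partial>M)"
      by (simp add: inner_sum_right inner_commute[of _ t] mult.commute)
  qed
qed

text \<open>Along a sequence with limit direction \<open>t\<close>, the difference quotients
  converge pointwise to \<open>d \<omega> \<bullet> t\<close>, which is nonnegative, and
  \<open>L\<close> dominates them. Integrability is required of differences of \<open>\<phi>\<close>
  only, because in the application \<open>\<phi>\<close> is known to be integrable only after an
  \<open>\<eta>\<close>-independent term is added.\<close>

lemma neg_gradient_in_normal_cone_integral:
  fixes s :: "'p::euclidean_space" and \<phi> :: "'s \<Rightarrow> 'p \<Rightarrow> real"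
  assumes grad: "\<And>\<omega>. neg_gradient_in_normal_cone S (\<phi> \<omega>) s"
    and int: "\<And>\<eta>. \<eta> \<in> S \<Longrightarrow> integrable M (\<lambda>\<omega>. \<phi> \<omega> \<eta> - \<phi> \<omega> s)"
    and diff: "\<And>\<eta>. \<eta> \<in> S \<Longrightarrow> F \<eta> - F s = (\<integral>\<omega>. \<phi> \<omega> \<eta> - \<phi> \<omega> s \<partial>M)"
    and "\<delta> > 0" and L: "integrable M L"
    and dom: "\<And>\<eta>. \<lbrakk>\<eta> \<in> S; norm (\<eta> - s) < \<delta>\<rbrakk> \<Longrightarrow> AE \<omega> in M. \<bar>\<phi> \<omega> \<eta> - \<phi> \<omega> s\<bar> \<le> L \<omega> * norm (\<eta> - s)"
  shows "neg_gradient_in_normal_cone S F s"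
proof -
  obtain d where d: "\<And>\<omega>. (\<phi> \<omega> has_derivative (\<lambda>h. d \<omega> \<bullet> h)) (at s within S)"
    "\<And>\<omega>. - d \<omega> \<in> normal_cone S s"
    using grad unfolding neg_gradient_in_normal_cone_def by metis
  obtain D where D: "\<And>t. integrable M (\<lambda>\<omega>. d \<omega> \<bullet> t) \<Longrightarrow> D \<bullet> t = (\<integral>\<omega>. d \<omega> \<bullet> t \<partial>M)"
    using exists_weak_integral[where M = M and d = d] by blast
  show ?thesis
  proof (rule neg_gradient_in_normal_coneI[where D = D])
    fix y t
    assume y: "\<And>m. y m \<in> S - {s}" "y \<longlonglongrightarrow> s" "(\<lambda>m. sgn (y m - s)) \<longlonglongrightarrow> t"
    define q where "q m \<omega> = (\<phi> \<omega> (y m) - \<phi> \<omega> s) / norm (y m - s)" for m \<omega>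
    have lim: "(\<lambda>m. q m \<omega>) \<longlonglongrightarrow> d \<omega> \<bullet> t" for \<omega>
      unfolding q_def by (rule has_derivative_within_LIMSEQ_direction[OF d(1) y])
    have q_int: "integrable M (q m)" for m
      unfolding q_def using y(1)[of m] int[of "y m"] by simp
    have q_meas: "q m \<in> borel_measurable M" for m
      using q_int by (rule borel_measurable_integrable)
    have lim_meas: "(\<lambda>\<omega>. d \<omega> \<bullet> t) \<in> borel_measurable M"
      by (rule borel_measurable_LIMSEQ_real[OF lim q_meas])
    have "\<forall>\<^sub>F m in sequentially. norm (y m - s) < \<delta>"
      using y(2) \<open>\<delta> > 0\<close> by (simp add: tendsto_iff dist_norm)
    \<comment> \<open>The bound by \<open>L\<close> holds only within distance \<delta> of
      \<open>s\<close>, so the sequence is shifted by \<open>N\<close> before dominated convergence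
      is applied.\<close>
    then obtain N where N: "\<And>m. N \<le> m \<Longrightarrow> norm (y m - s) < \<delta>"
      by (auto simp: eventually_sequentially)
    have bound: "AE \<omega> in M. norm (q (m + N) \<omega>) \<le> L \<omega>" for m
    proof -
      have "AE \<omega> in M. \<bar>\<phi> \<omega> (y (m + N)) - \<phi> \<omega> s\<bar> \<le> L \<omega> * norm (y (m + N) - s)"
        using y(1) by (intro dom N) auto
      then show ?thesis
        by eventually_elim (use y(1) in \<open>simp add: q_def field_simps\<close>)
    qed
    have "AE \<omega> in M. (\<lambda>m. q (m + N) \<omega>) \<longlonglongrightarrow> d \<omega> \<bullet> t"
      by (intro always_eventually allI LIMSEQ_ignore_initial_segment lim)
    note dc = lim_meas q_meas L this bound
    \<comment> \<open>Dominated convergence first supplies integrability of the limit, which is the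
      condition under which \<open>D\<close> is known to represent the integral.\<close>
    have Dt: "D \<bullet> t = (\<integral>\<omega>. d \<omega> \<bullet> t \<partial>M)"
      by (rule D, rule integrable_dominated_convergence[OF dc])
    have "(\<lambda>m. \<integral>\<omega>. q (m + N) \<omega> \<partial>M) \<longlonglongrightarrow> D \<bullet> t"
      unfolding Dt by (rule integral_dominated_convergence[OF dc])
    then have "(\<lambda>m. \<integral>\<omega>. q m \<omega> \<partial>M) \<longlonglongrightarrow> D \<bullet> t"
      by (rule LIMSEQ_offset)
    also have "(\<lambda>m. \<integral>\<omega>. q m \<omega> \<partial>M) = (\<lambda>m. (F (y m) - F s) / norm (y m - s))"
      using y(1) by (simp add: q_def diff)
    finally have "(\<lambda>m. (F (y m) - F s) / norm (y m - s)) \<longlonglongrightarrow> D \<bullet> t" .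
    moreover have "0 \<le> D \<bullet> t"
      unfolding Dt using normal_cone_inner_direction_le[OF d(2) y] by simp
    ultimately show "(\<lambda>m. (F (y m) - F s) / norm (y m - s)) \<longlonglongrightarrow> D \<bullet> t \<and> 0 \<le> D \<bullet> t" ..
  qed
qed

subsection \<open>Independence of the past and the next disturbance\<close>

lemma C2_on_imp_continuous_on: "C2_on S g \<Longrightarrow> continuous_on S g"
  unfolding C2_on_def by (elim exE conjE, rule has_derivative_continuous_on) (erule bspec)

text \<open>Regularity of \<open>f\<close> is known only for controls in \<open>A\<close>. Extending
  it by zero outside the closed set \<open>UNIV \<times> A \<times> UNIV\<close> gives a Borel
  function, and feedback with values in \<open>A\<close> never sees the extension.\<close>

lemma C2_on_feedback_measurable:
  fixes f :: "'x::euclidean_space \<Rightarrow> 'u::euclidean_space \<Rightarrow> 'w::euclidean_space \<Rightarrow> 'b::euclidean_space"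
  assumes "C2_on (UNIV \<times> A \<times> UNIV) (\<lambda>(x, u, v). f x u v)" and "closed A"
    and "h \<in> borel_measurable borel" and h: "\<And>x. h x \<in> A"
  shows "(\<lambda>(x, v). f x (h x) v) \<in> borel_measurable borel"
proof -
  have "closed (UNIV \<times> A \<times> UNIV :: ('x \<times> 'u \<times> 'w) set)"
    using \<open>closed A\<close> by (intro closed_Times) auto
  with assms(1) have ext: "(\<lambda>p. indicator (UNIV \<times> A \<times> UNIV) p *\<^sub>R (\<lambda>(x, u, v). f x u v) p) \<in> borel_measurable borel"
    by (intro borel_measurable_continuous_on_indicator C2_on_imp_continuous_on borel_closed)
  have "(\<lambda>p. (fst p, h (fst p), snd p)) \<in> borel_measurable (borel :: ('x \<times> 'w) measure)"
    by (intro borel_measurable_Pair measurable_compose[OF _ assms(3)] borel_measurable_continuous_onI continuous_intros)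
  from measurable_compose[OF this ext] show ?thesis
    by (simp add: h case_prod_unfold)
qed

context prob_space
begin

text \<open>The product formula identifies the joint law of \<open>(Y, W)\<close> with the product
  of the marginals by agreement on rectangles. Fubini's theorem for the product is then pulled back
  to \<open>M\<close>.\<close>

lemma indep_Fubini:
  fixes h :: "'b \<times> 'c \<Rightarrow> real"
  assumes [measurable]: "Y \<in> measurable M S" "W \<in> measurable M T"
    and indep: "\<And>A B. \<lbrakk>A \<in> sets S; B \<in> sets T\<rbrakk> \<Longrightarrow>
      prob ((Y -` A \<inter> space M) \<inter> (W -` B \<inter> space M)) = prob (Y -` A \<inter> space M) * prob (W -` B \<inter> space M)"
    and [measurable]: "h \<in> borel_measurable (S \<Otimes>\<^sub>M T)"
    and int: "integrable M (\<lambda>\<omega>. h (Y \<omega>, W \<omega>))"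
  shows "integrable M (\<lambda>\<omega>. \<integral>\<omega>'. h (Y \<omega>, W \<omega>') \<partial>M)"
    and "(\<integral>\<omega>. (\<integral>\<omega>'. h (Y \<omega>, W \<omega>') \<partial>M) \<partial>M) = (\<integral>\<omega>. h (Y \<omega>, W \<omega>) \<partial>M)"
proof -
  interpret Y: prob_space "distr M S Y"
    by (rule prob_space_distr) simp
  interpret W: prob_space "distr M T W"
    by (rule prob_space_distr) simp
  interpret pair_sigma_finite "distr M S Y" "distr M T W" ..
  have joint: "distr M S Y \<Otimes>\<^sub>M distr M T W = distr M (S \<Otimes>\<^sub>M T) (\<lambda>\<omega>. (Y \<omega>, W \<omega>))"
  proof (rule pair_measure_eqI)
    fix A B
    assume "A \<in> sets (distr M S Y)" "B \<in> sets (distr M T W)"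
    then have [measurable]: "A \<in> sets S" "B \<in> sets T"
      by simp_all
    have "(\<lambda>\<omega>. (Y \<omega>, W \<omega>)) -` (A \<times> B) \<inter> space M = (Y -` A \<inter> space M) \<inter> (W -` B \<inter> space M)"
      by auto
    then show "emeasure (distr M S Y) A * emeasure (distr M T W) B =
        emeasure (distr M (S \<Otimes>\<^sub>M T) (\<lambda>\<omega>. (Y \<omega>, W \<omega>))) (A \<times> B)"
      by (simp add: emeasure_distr emeasure_eq_measure indep ennreal_mult)
  qed (auto intro!: Y.sigma_finite_measure_axioms W.sigma_finite_measure_axioms cong: sets_pair_measure_cong)
  have int': "integrable (distr M S Y \<Otimes>\<^sub>M distr M T W) h"
    unfolding joint using int by (simp add: integrable_distr_eq)
  have inner: "(\<integral>v. h (x, v) \<partial>distr M T W) = (\<integral>\<omega>'. h (x, W \<omega>') \<partial>M)" if "x \<in> space S" for x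
    using that by (subst integral_distr) auto
  have meas[measurable]: "(\<lambda>x. \<integral>v. h (x, v) \<partial>distr M T W) \<in> borel_measurable S"
    by measurable
  have Y: "Y \<omega> \<in> space S" if "\<omega> \<in> space M" for \<omega>
    using that measurable_space[of Y M S] by simp
  have "integrable M (\<lambda>\<omega>. \<integral>v. h (Y \<omega>, v) \<partial>distr M T W)"
    using integrable_fst'[OF int'] by (simp add: integrable_distr_eq)
  then show "integrable M (\<lambda>\<omega>. \<integral>\<omega>'. h (Y \<omega>, W \<omega>') \<partial>M)"
    by (simp add: inner Y cong: Bochner_Integration.integrable_cong)
  have "(\<integral>\<omega>. (\<integral>v. h (Y \<omega>, v) \<partial>distr M T W) \<partial>M) = (\<integral>\<omega>. h (Y \<omega>, W \<omega>) \<partial>M)"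
    using integral_fst'[OF int'] unfolding joint by (simp add: integral_distr)
  then show "(\<integral>\<omega>. (\<integral>\<omega>'. h (Y \<omega>, W \<omega>') \<partial>M) \<partial>M) = (\<integral>\<omega>. h (Y \<omega>, W \<omega>) \<partial>M)"
    by (simp add: inner Y cong: Bochner_Integration.integral_cong)
qed

end

section \<open>The filtration generated by the initial state and the disturbances\<close>

definition init_noise_events ::
  "'s measure \<Rightarrow> ('s \<Rightarrow> 'x::topological_space) \<Rightarrow> (nat \<Rightarrow> 's \<Rightarrow> 'w::topological_space) \<Rightarrow> nat \<Rightarrow> 's set set" where
  "init_noise_events M x0 w i =
     (case i of 0 \<Rightarrow> {x0 -` B \<inter> space M |B. B \<in> sets borel}
      | Suc k \<Rightarrow> {w k -` B \<inter> space M |B. B \<in> sets borel})"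

text \<open>Index 0 stands for \<open>x0\<close> and index \<open>Suc j\<close> for
  \<open>w j\<close>, so the union up to \<open>k\<close> ends with \<open>w (k - 1)\<close>: the
  information available before \<open>w k\<close> is drawn.\<close>

definition history ::
  "'s measure \<Rightarrow> ('s \<Rightarrow> 'x::topological_space) \<Rightarrow> (nat \<Rightarrow> 's \<Rightarrow> 'w::topological_space) \<Rightarrow> nat \<Rightarrow> 's measure" where
  "history M x0 w k = sigma (space M) (\<Union>i\<le>k. init_noise_events M x0 w i)"

lemma init_noise_events_subset: "init_noise_events M x0 w i \<subseteq> Pow (space M)"
  by (auto simp: init_noise_events_def split: nat.splits)

lemma space_history [simp]: "space (history M x0 w k) = space M"
  and sets_history: "sets (history M x0 w k) = sigma_sets (space M) (\<Union>i\<le>k. init_noise_events M x0 w i)"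
  unfolding history_def using init_noise_events_subset
  by (intro space_measure_of sets_measure_of; blast)+

lemma init_noise_events_history: "i \<le> k \<Longrightarrow> init_noise_events M x0 w i \<subseteq> sets (history M x0 w k)"
  unfolding sets_history by (auto intro: sigma_sets.Basic)

lemma measurable_x0_history: "x0 \<in> borel_measurable (history M x0 w k)"
  using init_noise_events_history[of 0 k M x0 w]
  by (intro measurableI) (auto simp: init_noise_events_def)

lemma measurable_w_history: "j < k \<Longrightarrow> w j \<in> borel_measurable (history M x0 w k)"
  using init_noise_events_history[of "Suc j" k M x0 w]
  by (intro measurableI) (auto simp: init_noise_events_def)

lemma Int_stable_vimage_borel: "Int_stable {X -` B \<inter> S |B. B \<in> sets borel}"
  unfolding Int_stable_def by (safe, rule_tac x = "B \<inter> Ba" in exI) auto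

text \<open>Disjoint blocks of an independent family with intersection-stable members generate
  independent sigma-algebras. The blocks are \<open>{..k}\<close>, which generates the history, and
  \<open>{Suc k}\<close>, the index of \<open>w k\<close>; both lie in \<open>{..n}\<close> because
  \<open>k < n\<close>.\<close>

lemma (in prob_space)
  assumes indep: "indep_init_noise M n x0 w" and "k < n"
  shows sets_history_subset: "sets (history M x0 w k) \<subseteq> events"
    and indep_set_history: "indep_set (sets (history M x0 w k)) {w k -` B \<inter> space M |B. B \<in> sets borel}"
proof -
  let ?E = "init_noise_events M x0 w"
  let ?I = "case_bool {..k} {Suc k}"
  have E: "indep_sets ?E {..n}"
    using indep unfolding indep_init_noise_def init_noise_events_def[abs_def] by auto
  have "indep_sets (\<lambda>b. sigma_sets (space M) (\<Union>i\<in>?I b. ?E i)) UNIV"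
  proof (rule indep_sets_collect_sigma)
    show "indep_sets ?E (\<Union>b\<in>UNIV. ?I b)"
      by (rule indep_sets_mono_index[OF _ E]) (use \<open>k < n\<close> in \<open>auto split: bool.splits\<close>)
    show "Int_stable (?E i)" for i
      by (auto simp: init_noise_events_def Int_stable_vimage_borel split: nat.split)
    show "disjoint_family_on ?I UNIV"
      by (auto simp: disjoint_family_on_def split: bool.splits)
  qed
  then show ind: "indep_set (sets (history M x0 w k)) {w k -` B \<inter> space M |B. B \<in> sets borel}"
    unfolding indep_set_def sets_history
    by (rule indep_sets_mono_sets)
      (auto simp: init_noise_events_def intro: sigma_sets.Basic split: bool.splits)
  then show "sets (history M x0 w k) \<subseteq> events"
    unfolding indep_sets2_eq by blast
qed

subsection \<open>Decomposition of the expected cost at a stage\<close>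

text \<open>The backward recursion reads only parameters from stage \<open>k\<close> on, whereas the
  trajectory and the past cost below read only earlier ones. Together these congruences localize a
  change of a single parameter.\<close>

lemma J_value_cong:
  "(\<And>i. k \<le> i \<Longrightarrow> i < n \<Longrightarrow> \<theta> i = \<theta>' i) \<Longrightarrow>
     J_value M n w f c cT \<mu> \<theta> k = J_value M n w f c cT \<mu> \<theta>' k"
proof (induction "n - k" arbitrary: k)
  case 0
  then show ?case
    by (simp add: J_value.simps)
next
  case (Suc m)
  then have "J_value M n w f c cT \<mu> \<theta> (Suc k) = J_value M n w f c cT \<mu> \<theta>' (Suc k)"
    by (intro Suc.hyps) auto
  with Suc.hyps(2) Suc.prems[of k] show ?case
    by (simp add: J_value.simps[of M n w f c cT \<mu> _ k])
qed

lemma trajectory_cong: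
  "(\<And>i. i < k \<Longrightarrow> \<theta> i = \<theta>' i) \<Longrightarrow> trajectory x0 w f \<mu> \<theta> k \<omega> = trajectory x0 w f \<mu> \<theta>' k \<omega>"
  by (induction k) auto

definition cost_before ::
  "('s \<Rightarrow> 'x) \<Rightarrow> (nat \<Rightarrow> 's \<Rightarrow> 'w) \<Rightarrow> (nat \<Rightarrow> 'x \<Rightarrow> 'u \<Rightarrow> 'w \<Rightarrow> 'x) \<Rightarrow>
   (nat \<Rightarrow> 'x \<Rightarrow> 'u \<Rightarrow> real) \<Rightarrow> ('p \<Rightarrow> 'x \<Rightarrow> 'u) \<Rightarrow> (nat \<Rightarrow> 'p) \<Rightarrow> nat \<Rightarrow> 's \<Rightarrow> real" where
  "cost_before x0 w f c \<mu> \<theta> k \<omega> =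
     (\<Sum>i<k. c i (trajectory x0 w f \<mu> \<theta> i \<omega>) (\<mu> (\<theta> i) (trajectory x0 w f \<mu> \<theta> i \<omega>)))"

lemma cost_before_cong:
  "(\<And>i. i < k \<Longrightarrow> \<theta> i = \<theta>' i) \<Longrightarrow> cost_before x0 w f c \<mu> \<theta> k \<omega> = cost_before x0 w f c \<mu> \<theta>' k \<omega>"
  unfolding cost_before_def
  by (intro sum.cong) (auto simp: trajectory_cong[of _ \<theta> \<theta>'])

text \<open>Collects what the cost decomposition needs for one fixed parameter sequence. The main
  proof instantiates it at the perturbed sequences \<open>\<theta>(k := \<eta>)\<close>, hence the
  measurability assumptions on the closed-loop maps rather than on \<open>f\<close>,
  \<open>c\<close> and \<open>\<mu>\<close> separately.\<close>

locale noisy_closed_loop = prob_space M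
  for M :: "'s measure" +
  fixes n :: nat
    and x0 :: "'s \<Rightarrow> 'x::euclidean_space"
    and w :: "nat \<Rightarrow> 's \<Rightarrow> 'w::euclidean_space"
    and f :: "nat \<Rightarrow> 'x \<Rightarrow> 'u \<Rightarrow> 'w \<Rightarrow> 'x"
    and c :: "nat \<Rightarrow> 'x \<Rightarrow> 'u \<Rightarrow> real"
    and cT :: "'x \<Rightarrow> real"
    and \<mu> :: "'p \<Rightarrow> 'x \<Rightarrow> 'u"
    and \<theta> :: "nat \<Rightarrow> 'p"
  assumes indep: "indep_init_noise M n x0 w"
    and f_measurable: "\<And>k. k < n \<Longrightarrow> (\<lambda>(x, v). f k x (\<mu> (\<theta> k) x) v) \<in> borel_measurable (borel \<Otimes>\<^sub>M borel)"
    and c_measurable: "\<And>k. k < n \<Longrightarrow> (\<lambda>x. c k x (\<mu> (\<theta> k) x)) \<in> borel_measurable borel"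
    and cT_measurable: "cT \<in> borel_measurable borel"
    and stage_integrable: "\<And>k x. k < n \<Longrightarrow> integrable M (\<lambda>\<omega>. c k x (\<mu> (\<theta> k) x) +
      J_value M n w f c cT \<mu> \<theta> (Suc k) (f k x (\<mu> (\<theta> k) x) (w k \<omega>)))"
begin

abbreviation "J \<equiv> J_value M n w f c cT \<mu> \<theta>"
abbreviation "X \<equiv> trajectory x0 w f \<mu> \<theta>"
abbreviation "C \<equiv> cost_before x0 w f c \<mu> \<theta>"

lemma J_step: "k < n \<Longrightarrow> J k x = (\<integral>\<omega>. c k x (\<mu> (\<theta> k) x) + J (Suc k) (f k x (\<mu> (\<theta> k) x) (w k \<omega>)) \<partial>M)"
  by (simp add: J_value.simps[of M n w f c cT \<mu> \<theta> k] stage_value_def)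

lemma w_measurable: "k < n \<Longrightarrow> w k \<in> borel_measurable M"
  using indep by (simp add: indep_init_noise_def)

lemma J_measurable: "k \<le> n \<Longrightarrow> J k \<in> borel_measurable borel"
proof (induction rule: inc_induct)
  case base
  then show ?case
    by (simp add: J_value_terminal cT_measurable)
next
  case (step k)
  note [measurable] = step.IH w_measurable[OF \<open>k < n\<close>] f_measurable[OF \<open>k < n\<close>] c_measurable[OF \<open>k < n\<close>]
  \<comment> \<open>The dynamics appear as an uncurried function applied to a pair, so that
    \<open>f_measurable\<close> matches.\<close>
  have "(\<lambda>(x, \<omega>). c k x (\<mu> (\<theta> k) x) + J (Suc k) ((\<lambda>(x, v). f k x (\<mu> (\<theta> k) x) v) (x, w k \<omega>)))
      \<in> borel_measurable (borel \<Otimes>\<^sub>M M)"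
    by measurable
  then have "(\<lambda>x. \<integral>\<omega>. c k x (\<mu> (\<theta> k) x) + J (Suc k) (f k x (\<mu> (\<theta> k) x) (w k \<omega>)) \<partial>M)
      \<in> borel_measurable borel"
    by (intro borel_measurable_lebesgue_integral) simp
  then show ?case
    by (simp add: J_step[OF \<open>k < n\<close>, abs_def])
qed

lemma trajectory_measurable_history: "\<lbrakk>j \<le> k; k \<le> n\<rbrakk> \<Longrightarrow> X j \<in> borel_measurable (history M x0 w k)"
proof (induction j)
  case 0
  then show ?case
    by (simp add: measurable_x0_history)
next
  case (Suc j)
  then have "j < n" "j < k"
    by auto
  note [measurable] = f_measurable[OF \<open>j < n\<close>] measurable_w_history[OF \<open>j < k\<close>, of w M x0]
  have [measurable]: "X j \<in> borel_measurable (history M x0 w k)"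
    using Suc by simp
  have "(\<lambda>\<omega>. (\<lambda>(x, v). f j x (\<mu> (\<theta> j) x) v) (X j \<omega>, w j \<omega>)) \<in> borel_measurable (history M x0 w k)"
    by measurable
  then show ?case
    by simp
qed

lemma cost_before_measurable_history:
  assumes "k \<le> n"
  shows "C k \<in> borel_measurable (history M x0 w k)"
  unfolding cost_before_def
proof (rule borel_measurable_sum)
  fix i
  assume "i \<in> {..<k}"
  with assms show "(\<lambda>\<omega>. c i (X i \<omega>) (\<mu> (\<theta> i) (X i \<omega>))) \<in> borel_measurable (history M x0 w k)"
    by (intro measurable_compose[OF trajectory_measurable_history c_measurable]) auto
qed

text \<open>The pair of past cost and state is measurable for the history, hence independent of
  \<open>w k\<close>; averaging over \<open>w k\<close> alone turns the next-stage expression into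
  the current one. The past cost stays inside the integrand because integrability is assumed only
  for the sum. Integrability passes from \<open>Suc k\<close> to \<open>k\<close>, so the induction
  that follows runs backward.\<close>

lemma cost_to_go_step:
  assumes "k < n" and int: "integrable M (\<lambda>\<omega>. C (Suc k) \<omega> + J (Suc k) (X (Suc k) \<omega>))"
  shows "integrable M (\<lambda>\<omega>. C k \<omega> + J k (X k \<omega>))"
    and "(\<integral>\<omega>. C k \<omega> + J k (X k \<omega>) \<partial>M) = (\<integral>\<omega>. C (Suc k) \<omega> + J (Suc k) (X (Suc k) \<omega>) \<partial>M)"
proof -
  let ?H = "history M x0 w k"
  define Y where "Y \<omega> = (C k \<omega>, X k \<omega>)" for \<omega>
  define h where "h p = fst (fst p) + (c k (snd (fst p)) (\<mu> (\<theta> k) (snd (fst p))) +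
      J (Suc k) ((\<lambda>(x, v). f k x (\<mu> (\<theta> k) x) v) (snd (fst p), snd p)))" for p
  have h: "h \<in> borel_measurable ((borel \<Otimes>\<^sub>M borel) \<Otimes>\<^sub>M borel)"
    unfolding h_def[abs_def] using \<open>k < n\<close>
    by (intro borel_measurable_add measurable_compose[OF _ c_measurable] measurable_compose[OF _ J_measurable]
        measurable_compose[OF _ f_measurable] measurable_Pair measurable_compose[OF measurable_fst]
        measurable_fst measurable_snd) auto
  have YH: "Y \<in> measurable ?H (borel \<Otimes>\<^sub>M borel)"
    unfolding Y_def using \<open>k < n\<close>
    by (intro measurable_Pair cost_before_measurable_history trajectory_measurable_history) auto
  have YM: "Y \<in> measurable M (borel \<Otimes>\<^sub>M borel)"
    by (rule measurable_from_subalg[OF _ YH])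
      (simp add: subalgebra_def sets_history_subset[OF indep \<open>k < n\<close>])
  have ind: "prob ((Y -` A \<inter> space M) \<inter> (w k -` B \<inter> space M)) = prob (Y -` A \<inter> space M) * prob (w k -` B \<inter> space M)"
    if "A \<in> sets (borel \<Otimes>\<^sub>M borel)" "B \<in> sets borel" for A B
  proof -
    have "Y -` A \<inter> space M \<in> sets ?H"
      using measurable_sets[OF YH that(1)] by simp
    moreover have "w k -` B \<inter> space M \<in> {w k -` B \<inter> space M |B. B \<in> sets borel}"
      using that(2) by (intro CollectI exI[of _ B] conjI refl)
    ultimately show ?thesis
      by (rule indep_setD[OF indep_set_history[OF indep \<open>k < n\<close>]])
  qed
  have int': "integrable M (\<lambda>\<omega>. h (Y \<omega>, w k \<omega>))"
    using int by (simp add: h_def Y_def cost_before_def add.assoc)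
  \<comment> \<open>With the past frozen, \<open>C k \<omega>\<close> is a constant integrated
    against a probability measure; the remaining integral is the recursion for \<open>J k\<close> at
    the state \<open>X k \<omega>\<close>.\<close>
  have inner: "(\<integral>\<omega>'. h (Y \<omega>, w k \<omega>') \<partial>M) = C k \<omega> + J k (X k \<omega>)" for \<omega>
    using stage_integrable[OF \<open>k < n\<close>, of "X k \<omega>"]
    by (simp add: h_def Y_def J_step[OF \<open>k < n\<close>] prob_space)
  note Fubini = indep_Fubini[where Y = Y and W = "w k" and h = h, OF YM w_measurable[OF \<open>k < n\<close>] ind h int']
  show "integrable M (\<lambda>\<omega>. C k \<omega> + J k (X k \<omega>))"
    using Fubini(1) by (simp only: inner)
  have "(\<integral>\<omega>. C k \<omega> + J k (X k \<omega>) \<partial>M) = (\<integral>\<omega>. h (Y \<omega>, w k \<omega>) \<partial>M)"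
    using Fubini(2) by (simp only: inner)
  then show "(\<integral>\<omega>. C k \<omega> + J k (X k \<omega>) \<partial>M) = (\<integral>\<omega>. C (Suc k) \<omega> + J (Suc k) (X (Suc k) \<omega>) \<partial>M)"
    by (simp add: h_def Y_def cost_before_def add.assoc)
qed

lemma total_cost_decomposition:
  assumes "k \<le> n" and "integrable M (total_cost n x0 w f c cT \<mu> \<theta>)"
  shows "integrable M (\<lambda>\<omega>. C k \<omega> + J k (X k \<omega>)) \<and>
    (\<integral>\<omega>. C k \<omega> + J k (X k \<omega>) \<partial>M) = (\<integral>\<omega>. total_cost n x0 w f c cT \<mu> \<theta> \<omega> \<partial>M)"
  using assms(1)
proof (induction rule: inc_induct)
  case base
  have "C n \<omega> + J n (X n \<omega>) = total_cost n x0 w f c cT \<mu> \<theta> \<omega>" for \<omega>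
    by (simp add: cost_before_def total_cost_def J_value_terminal)
  with assms(2) show ?case
    by simp
next
  case (step k)
  then show ?case
    using cost_to_go_step[of k] by simp
qed

end

subsection \<open>Stationarity\<close>

theorem theorem8:
  fixes M :: "'s measure"
    and n :: nat
    and x0 :: "'s \<Rightarrow> 'x::euclidean_space"
    and w :: "nat \<Rightarrow> 's \<Rightarrow> 'w::euclidean_space"
    and A :: "'u::euclidean_space set"
    and f :: "nat \<Rightarrow> 'x \<Rightarrow> 'u \<Rightarrow> 'w \<Rightarrow> 'x"
    and c :: "nat \<Rightarrow> 'x \<Rightarrow> 'u \<Rightarrow> real"
    and cT :: "'x \<Rightarrow> real"
    and \<Theta> :: "'p::euclidean_space set"
    and \<mu> :: "'p \<Rightarrow> 'x \<Rightarrow> 'u"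
    and \<theta> :: "nat \<Rightarrow> 'p"
  assumes "prob_space M" and "complete_measure M"
    and "indep_init_noise M n x0 w"
    and "compact A"
    and "\<And>k. k < n \<Longrightarrow> C2_on (UNIV \<times> A \<times> UNIV) (\<lambda>(x, u, v). f k x u v)"
    and "\<And>k. k < n \<Longrightarrow> C2_on UNIV (\<lambda>(x, u). c k x u)"
    and "C2_on UNIV cT"
    and "\<And>\<eta> x. \<eta> \<in> \<Theta> \<Longrightarrow> \<mu> \<eta> x \<in> A"
    and "\<And>\<eta>. \<eta> \<in> \<Theta> \<Longrightarrow> bounded (range (\<mu> \<eta>))"
    and "\<And>\<eta>. \<eta> \<in> \<Theta> \<Longrightarrow> \<mu> \<eta> \<in> borel_measurable borel"
    and "\<And>\<epsilon>::real. \<epsilon> > 0 \<Longrightarrow> \<exists>\<delta>>0. \<forall>\<eta>\<in>\<Theta>. \<forall>\<eta>'\<in>\<Theta>. norm (\<eta> - \<eta>') < \<delta> \<longrightarrow>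
           (SUP x. norm (\<mu> \<eta> x - \<mu> \<eta>' x)) < \<epsilon>"
    and "expectations_well_defined M n x0 w A f c cT \<Theta> \<mu>"
    and "DP_stationary M n w f c cT \<Theta> \<mu> \<theta>"
    and "\<And>k x. k < n \<Longrightarrow> \<exists>V. open V \<and> \<theta> k \<in> V \<and> C1_on (\<Theta> \<inter> V) (\<lambda>\<eta>. \<mu> \<eta> x)"
    and "\<And>k. k < n \<Longrightarrow> C1_on UNIV (\<mu> (\<theta> k))"
    and "\<And>k. k < n \<Longrightarrow> dominated_difference_quotients M n x0 w f c cT \<Theta> \<mu> \<theta> k"
  shows "one_shot_stationary M n x0 w f c cT \<Theta> \<mu> \<theta>"
proof -
  interpret prob_space M
    by fact
  have \<theta>: "\<theta> \<in> {..<n} \<rightarrow> \<Theta>"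
    using assms(13) by (simp add: DP_stationary_def)
  \<comment> \<open>Needed for every admissible sequence, since derivatives at \<theta> compare it
    with its perturbations.\<close>
  have loop: "noisy_closed_loop M n x0 w f c cT \<mu> \<theta>'" if \<theta>': "\<theta>' \<in> {..<n} \<rightarrow> \<Theta>" for \<theta>'
  proof
    show "indep_init_noise M n x0 w"
      by fact
    show "cT \<in> borel_measurable borel"
      using assms(7) by (intro borel_measurable_continuous_onI C2_on_imp_continuous_on)
    fix k
    assume k: "k < n"
    with \<theta>' have \<theta>'_k: "\<theta>' k \<in> \<Theta>"
      by auto
    note [measurable] = assms(10)[OF \<theta>'_k]
    show "(\<lambda>(x, v). f k x (\<mu> (\<theta>' k) x) v) \<in> borel_measurable (borel \<Otimes>\<^sub>M borel)"
      unfolding borel_prod using assms(8)[OF \<theta>'_k]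
      by (intro C2_on_feedback_measurable[OF assms(5)[OF k] compact_imp_closed[OF assms(4)]]) auto
    have [measurable]: "(\<lambda>(x, u). c k x u) \<in> borel_measurable (borel \<Otimes>\<^sub>M borel)"
      unfolding borel_prod using assms(6)[OF k]
      by (intro borel_measurable_continuous_onI C2_on_imp_continuous_on)
    have "(\<lambda>x. (\<lambda>(x, u). c k x u) (x, \<mu> (\<theta>' k) x)) \<in> borel_measurable borel"
      by measurable
    then show "(\<lambda>x. c k x (\<mu> (\<theta>' k) x)) \<in> borel_measurable borel"
      by simp
    show "integrable M (\<lambda>\<omega>. c k x (\<mu> (\<theta>' k) x) +
        J_value M n w f c cT \<mu> \<theta>' (Suc k) (f k x (\<mu> (\<theta>' k) x) (w k \<omega>)))" for x
      using assms(12) k \<theta>' assms(8)[OF \<theta>'_k] unfolding expectations_well_defined_def by blast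
  qed
  have "neg_gradient_in_normal_cone \<Theta> (\<lambda>\<eta>. one_shot_objective M n x0 w f c cT \<mu> (\<theta>(k := \<eta>))) (\<theta> k)"
    if k: "k < n" for k
  proof -
    define X where "X = trajectory x0 w f \<mu> \<theta> k"
    define C where "C = cost_before x0 w f c \<mu> \<theta> k"
    define \<phi> where "\<phi> \<omega> \<eta> = Q_value M n w f c cT \<mu> \<theta> k (X \<omega>) (\<mu> \<eta> (X \<omega>))" for \<omega> \<eta>
    define F where "F \<eta> = one_shot_objective M n x0 w f c cT \<mu> (\<theta>(k := \<eta>))" for \<eta>
    \<comment> \<open>Decomposition at stage \<open>k\<close> for the sequence
      \<open>\<theta>(k := \<eta>)\<close>: its past cost, its state at \<open>k\<close> and its
      continuation value from \<open>Suc k\<close> are those of \<theta>, so \<eta> enters only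
      through the control at stage \<open>k\<close>. The standing assumption identifies
      \<open>F \<eta>\<close> with the expected total cost.\<close>
    have split: "integrable M (\<lambda>\<omega>. C \<omega> + \<phi> \<omega> \<eta>) \<and> (\<integral>\<omega>. C \<omega> + \<phi> \<omega> \<eta> \<partial>M) = F \<eta>"
      if "\<eta> \<in> \<Theta>" for \<eta>
    proof -
      have \<theta>': "\<theta>(k := \<eta>) \<in> {..<n} \<rightarrow> \<Theta>"
        using \<theta> that by auto
      interpret noisy_closed_loop M n x0 w f c cT \<mu> "\<theta>(k := \<eta>)"
        by (rule loop) fact
      have "integrable M (total_cost n x0 w f c cT \<mu> (\<theta>(k := \<eta>)))"
        "F \<eta> = (\<integral>\<omega>. total_cost n x0 w f c cT \<mu> (\<theta>(k := \<eta>)) \<omega> \<partial>M)"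
        using assms(12) \<theta>' unfolding expectations_well_defined_def F_def by blast+
      moreover have "J_value M n w f c cT \<mu> (\<theta>(k := \<eta>)) (Suc k) = J_value M n w f c cT \<mu> \<theta> (Suc k)"
        by (rule J_value_cong) simp
      then have "J_value M n w f c cT \<mu> (\<theta>(k := \<eta>)) k (X \<omega>) = \<phi> \<omega> \<eta>" for \<omega>
        using k by (simp add: J_value_step Q_value_def \<phi>_def)
      moreover have "trajectory x0 w f \<mu> (\<theta>(k := \<eta>)) k \<omega> = X \<omega>" for \<omega>
        unfolding X_def by (rule trajectory_cong) simp
      moreover have "cost_before x0 w f c \<mu> (\<theta>(k := \<eta>)) k \<omega> = C \<omega>" for \<omega>
        unfolding C_def by (rule cost_before_cong) simp
      ultimately show ?thesis
        using total_cost_decomposition[of k] k by simp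
    qed
    have \<theta>_k: "\<theta> k \<in> \<Theta>"
      using \<theta> k by auto
    have grad: "neg_gradient_in_normal_cone \<Theta> (\<phi> \<omega>) (\<theta> k)" for \<omega>
      using assms(13) k unfolding DP_stationary_def \<phi>_def[abs_def] by blast
    \<comment> \<open>Only \<open>C \<omega> + \<phi> \<omega> \<eta>\<close> is known to be
      integrable; the common term \<open>C \<omega>\<close> cancels in the difference.\<close>
    have cancel: "\<phi> \<omega> \<eta> - \<phi> \<omega> (\<theta> k) = (C \<omega> + \<phi> \<omega> \<eta>) - (C \<omega> + \<phi> \<omega> (\<theta> k))" for \<omega> \<eta>
      by simp
    have int: "integrable M (\<lambda>\<omega>. \<phi> \<omega> \<eta> - \<phi> \<omega> (\<theta> k))" if "\<eta> \<in> \<Theta>" for \<eta>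
      unfolding cancel using split[OF that] split[OF \<theta>_k] by (intro Bochner_Integration.integrable_diff) auto
    have diff: "F \<eta> - F (\<theta> k) = (\<integral>\<omega>. \<phi> \<omega> \<eta> - \<phi> \<omega> (\<theta> k) \<partial>M)" if "\<eta> \<in> \<Theta>" for \<eta>
      unfolding cancel using split[OF that] split[OF \<theta>_k]
      by (subst Bochner_Integration.integral_diff) auto
    obtain \<delta> L where "\<delta> > 0" "integrable M L" and
      "\<And>\<eta>. \<lbrakk>\<eta> \<in> \<Theta>; norm (\<eta> - \<theta> k) < \<delta>\<rbrakk> \<Longrightarrow>
        AE \<omega> in M. \<bar>\<phi> \<omega> \<eta> - \<phi> \<omega> (\<theta> k)\<bar> \<le> L \<omega> * norm (\<eta> - \<theta> k)"
      using assms(16)[OF k] unfolding dominated_difference_quotients_def Let_def \<phi>_def X_def by blast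
    then have "neg_gradient_in_normal_cone \<Theta> F (\<theta> k)"
      using neg_gradient_in_normal_cone_integral[of \<Theta> \<phi> "\<theta> k" M F \<delta> L] grad int diff by blast
    then show ?thesis
      by (simp add: F_def[abs_def])
  qed
  with \<theta> show ?thesis
    unfolding one_shot_stationary_def by blast
qed

end
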